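(* Let $n\ge k\ge 2$, let $G$ be a $k$-uniform hypergraph with vertex set $[n]$, and let $\mathbf{x}$ be a unit nonnegative eigenvector of $\mathcal{A}(G)$ corresponding to $\rho(G)$. Let $\emptyset\ne I\subset[n]$ be a proper subset. Then $$\rho(G)\Bigl(1-k\sum_{i\in I}x_i^k\Bigr)+k\sum_{j=2}^{k}\ \sum_{e\in E(G):\,|e\cap I|=j}(j-1)\mathbf{x}^e\ \le\ \rho(G-I)\ \le\ \rho(G).$$ Moreover, if $\sum_{i\in I}x_i^k\ne 1$ (for example, if $G$ is connected), then $$\frac{\rho(G)\Bigl(1-k\sum_{i\in I}x_i^k\Bigr)+k\sum_{j=2}^{k}\ \sum_{e\in E(G):\,|e\cap I|=j}(j-1)\mathbf{x}^e}{1-\sum_{i\in I}x_i^k}\ \le\ \rho(G-I)\ \le\ \rho(G).$$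
   Context: $[n]=\{1,\dots,n\}$. A $k$-uniform hypergraph $G$ has vertex set $V(G)$ and edge set $E(G)$ consisting of $k$-element subsets of $V(G)$. Its adjacency tensor $\mathcal{A}(G)=(a_{i_1\dots i_k})$ has order $k$ and dimension $|V(G)|$, with $a_{i_1\dots i_k}=\frac{1}{(k-1)!}$ if $\{i_1,\dots,i_k\}\in E(G)$ and $0$ otherwise. For a vector $\mathbf{x}$ indexed by $V(G)$ and $U\subseteq V(G)$, $\mathbf{x}^U=\prod_{w\in U}x_w$. A nonzero $\mathbf{x}$ is an eigenvector of $\mathcal{A}(G)$ for the eigenvalue $\lambda$ if $\lambda x_u^{k-1}=\sum_{e\in E(G),\,u\in e}\mathbf{x}^{e\setminus\{u\}}$ for all $u\in V(G)$. The spectral radius $\rho(G)$ is the largest modulus of the (complex) eigenvalues of $\mathcal{A}(G)$; it equals the largest H-eigenvalue (real eigenvalue with a real eigenvector). A real vector is unit if $\sum_i|x_i|^k=1$. $G-I$ is the hypergraph with vertex set $V(G)\setminus I$ whose edges are the edges of $G$ disjoint from $I$. *)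

theory Defs
  imports Complex_Main "HOL-Combinatorics.Multiset_Permutations"
begin

record 'a hypergraph =
  verts :: "'a set"
  edges :: "'a set set"

definition uniform_hypergraph :: "nat \<Rightarrow> 'a hypergraph \<Rightarrow> bool" where
  "uniform_hypergraph k G \<longleftrightarrow>
     finite (verts G) \<and> (\<forall>e\<in>edges G. e \<subseteq> verts G \<and> card e = k)"

definition delete_verts :: "'a hypergraph \<Rightarrow> 'a set \<Rightarrow> 'a hypergraph" where
  "delete_verts G I =
     \<lparr>verts = verts G - I, edges = {e \<in> edges G. e \<inter> I = {}}\<rparr>"

definition hyper_connected :: "'a hypergraph \<Rightarrow> bool" where
  "hyper_connected G \<longleftrightarrow>
     (\<forall>u\<in>verts G. \<forall>v\<in>verts G. (u, v) \<in> {(a, b). \<exists>e\<in>edges G. a \<in> e \<and> b \<in> e}\<^sup>*)"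

text \<open>
  A tensor of order \<open>k\<close> over an index set \<open>V\<close> is a function on the lists of length \<open>k\<close> over \<open>V\<close>.
  The scalars are left polymorphic: \<open>complex\<close> gives all eigenvalues, and \<open>real\<close> gives the
  H-eigenvalues.  A vector indexed by \<open>V\<close> is a function of which only the values on \<open>V\<close> matter.
\<close>

definition adjacency_tensor :: "nat \<Rightarrow> 'a hypergraph \<Rightarrow> 'a list \<Rightarrow> 'b::field_char_0" where
  "adjacency_tensor k G js = (if set js \<in> edges G then 1 / fact (k - 1) else 0)"

text \<open>
  \<open>A x\<^sup>k\<^sup>-\<^sup>1 = \<mu> x\<^sup>[\<^sup>k\<^sup>-\<^sup>1\<^sup>]\<close> with \<open>x \<noteq> 0\<close>.  For the adjacency tensor, the lemma
  \<open>eigenpair_adjacency_tensor_iff\<close> rewrites this as the system of edge equations.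
\<close>

definition eigenpair ::
    "nat \<Rightarrow> 'a set \<Rightarrow> ('a list \<Rightarrow> 'b::field_char_0) \<Rightarrow> 'b \<Rightarrow> ('a \<Rightarrow> 'b) \<Rightarrow> bool" where
  "eigenpair k V A \<mu> x \<longleftrightarrow>
     (\<exists>u\<in>V. x u \<noteq> 0) \<and>
     (\<forall>u\<in>V. (\<Sum>js | set js \<subseteq> V \<and> length js = k - 1. A (u # js) * prod_list (map x js))
              = \<mu> * x u ^ (k - 1))"

definition spectral_radius :: "nat \<Rightarrow> 'a hypergraph \<Rightarrow> real" where
  "spectral_radius k G =
     (GREATEST r. \<exists>\<mu>::complex. (\<exists>x. eigenpair k (verts G) (adjacency_tensor k G) \<mu> x) \<and> r = cmod \<mu>)"

definition unit_vector :: "nat \<Rightarrow> 'a set \<Rightarrow> ('a \<Rightarrow> real) \<Rightarrow> bool" where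
  "unit_vector k V x \<longleftrightarrow> (\<Sum>i\<in>V. \<bar>x i\<bar> ^ k) = 1"

lemma adjacency_tensor_apply:
  fixes x :: "'a \<Rightarrow> 'b::field_char_0"
  assumes G: "uniform_hypergraph k G" and k: "k \<ge> 1"
  shows "(\<Sum>js | set js \<subseteq> verts G \<and> length js = k - 1.
            adjacency_tensor k G (u # js) * prod_list (map x js))
         = (\<Sum>e | e \<in> edges G \<and> u \<in> e. \<Prod>w\<in>e - {u}. x w)"
proof -
  let ?V = "verts G"
  let ?L = "{js. set js \<subseteq> ?V \<and> length js = k - 1}"
  let ?D = "{e \<in> edges G. u \<in> e}"
  let ?S = "SIGMA e:?D. permutations_of_set (e - {u})"
  let ?f = "\<lambda>js. adjacency_tensor k G (u # js) * prod_list (map x js)"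
  have finV: "finite ?V" and sub: "\<And>e. e \<in> edges G \<Longrightarrow> e \<subseteq> ?V \<and> card e = k"
    using G by (auto simp: uniform_hypergraph_def)
  have finE: "\<And>e. e \<in> edges G \<Longrightarrow> finite e"
    using sub finV finite_subset by blast
  have "edges G \<subseteq> Pow ?V" using sub by blast
  then have finD: "finite ?D" using finV by (auto intro: finite_subset)
  have finL: "finite ?L" using finite_lists_length_eq[OF finV, of "k - 1"] by simp
  have dist: "distinct (u # js)" if "js \<in> ?L" "set (u # js) \<in> edges G" for js
  proof (rule card_distinct)
    show "card (set (u # js)) = length (u # js)" using sub[OF that(2)] that(1) k by simp
  qed
  have "(\<Sum>js\<in>?L. ?f js) = (\<Sum>js\<in>{js\<in>?L. set (u # js) \<in> edges G}. ?f js)"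
    by (rule sum.mono_neutral_right) (use finL in \<open>auto simp: adjacency_tensor_def\<close>)
  also have "\<dots> = (\<Sum>(e, js)\<in>?S. prod x (e - {u}) / fact (k - 1))"
  proof (rule sum.reindex_bij_witness[where i = snd and j = "\<lambda>js. (set (u # js), js)"], goal_cases)
    case (2 a)
    then show ?case using dist[of a] by (auto simp: permutations_of_set_def)
  next
    case (4 b)
    then obtain e js where b: "b = (e, js)" "e \<in> edges G" "u \<in> e" "set js = e - {u}" "distinct js"
      by (auto simp: permutations_of_set_def)
    then have *: "set (u # js) = e" by auto
    have "length js = k - 1"
      using b sub[OF b(2)] finE[OF b(2)] distinct_card[OF b(5)] by simp
    then show ?case using b * sub[OF b(2)] by auto
  next
    case (3 b)
    then obtain e js where b: "b = (e, js)" "u \<in> e" "set js = e - {u}"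
      by (auto simp: permutations_of_set_def)
    then have "set (u # js) = e" by auto
    then show ?case using b(1) by simp
  next
    case (5 a)
    then have d: "distinct (u # a)" using dist[of a] by blast
    then have "prod_list (map x a) = prod x (set a)"
      by (simp add: prod.distinct_set_conv_list)
    moreover have "set (u # a) - {u} = set a" using d by simp
    moreover have "set (u # a) \<in> edges G" using 5 by blast
    ultimately show ?case by (simp only: prod.case adjacency_tensor_def if_True) simp
  qed simp
  also have "\<dots> = (\<Sum>e\<in>?D. \<Sum>js\<in>permutations_of_set (e - {u}). prod x (e - {u}) / fact (k - 1))"
    by (rule sum.Sigma[symmetric]) (use finD in auto)
  also have "\<dots> = (\<Sum>e\<in>?D. prod x (e - {u}))"
  proof (rule sum.cong[OF refl])
    fix e assume "e \<in> ?D"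
    then have "card (permutations_of_set (e - {u})) = fact (k - 1)"
      using sub[of e] finE[of e] by (simp add: card_permutations_of_set)
    then show "(\<Sum>js\<in>permutations_of_set (e - {u}). prod x (e - {u}) / fact (k - 1)) = prod x (e - {u})"
      by simp
  qed
  finally show ?thesis .
qed

lemma eigenpair_adjacency_tensor_iff:
  fixes x :: "'a \<Rightarrow> 'b::field_char_0"
  assumes "uniform_hypergraph k G" and "k \<ge> 1"
  shows "eigenpair k (verts G) (adjacency_tensor k G) \<mu> x \<longleftrightarrow>
     (\<exists>u\<in>verts G. x u \<noteq> 0) \<and>
     (\<forall>u\<in>verts G. \<mu> * x u ^ (k - 1) = (\<Sum>e | e \<in> edges G \<and> u \<in> e. \<Prod>w\<in>e - {u}. x w))"
  unfolding eigenpair_def adjacency_tensor_apply[OF assms]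
  by (simp only: eq_commute[of "\<mu> * _"])

end

theory Submission
  imports Defs "HOL-Analysis.Function_Topology"
begin

text \<open>
  The whole argument rests on a variational formula: for \<open>k \<ge> 2\<close> and a nonempty vertex set,
  \<open>\<rho>(G)\<close> is the maximum of \<open>k \<Sum>\<^sub>e z\<^sup>e\<close> over nonnegative \<open>z\<close> with \<open>\<Sum> z\<^sub>v\<^sup>k = 1\<close>
  (\<open>spectral_radius_variational\<close>).  A maximizer exists by compactness and satisfies the
  eigenvalue equations, even at coordinates where it vanishes
  (\<open>maximizer_eigenpair\<close>); conversely the triangle inequality bounds the modulus of every complex eigenvalue by the value of the
  polynomial at the vector of moduli (\<open>eigenvalue_norm_bound\<close>).

  Write \<open>S = \<Sum>\<^bsub>i\<in>I\<^esub> x\<^sub>i\<^sup>k\<close>.  Multiplying the eigenvalue equation at \<open>u\<close> by \<open>x\<^sub>u\<close> and summing over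
  \<open>u \<in> I\<close> counts an edge \<open>e\<close> exactly \<open>|e \<inter> I|\<close> times.  Summing over all of \<open>V(G)\<close> gives
  \<open>\<rho>(G) = k \<Sum>\<^sub>e x\<^sup>e\<close>, and summing over \<open>I\<close> gives \<open>\<rho>(G) S = \<Sum>\<^sub>e |e \<inter> I| x\<^sup>e\<close>.  Subtracting \<open>k\<close> times the
  second identity from the first cancels every edge that meets \<open>I\<close> in exactly one vertex, and
  subtracts \<open>k x\<^sup>e\<close> exactly \<open>|e \<inter> I| - 1\<close> times too often for the other edges that meet \<open>I\<close>.  The
  double sum corrects this excess, so the numerator of the lower bound is exactly \<open>k\<close> times the
  edge sum of \<open>G - I\<close> at \<open>x\<close> (\<open>edge_poly_delete_verts\<close>).  As the
  restriction of \<open>x\<close> to \<open>V(G) - I\<close> has \<open>k\<close>-th power sum \<open>1 - S\<close>, the variational formula for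
  \<open>G - I\<close> bounds this by \<open>\<rho>(G - I) (1 - S)\<close>, from which both lower bounds follow.  The upper
  bound follows by extending a maximizer for \<open>G - I\<close> by zero.

  If \<open>G\<close> is connected, then \<open>x\<close> is positive everywhere (\<open>principal_eigenvector_pos\<close>), hence \<open>S < 1\<close>.
\<close>

section \<open>The edge polynomial\<close>

definition edge_poly :: "'a hypergraph \<Rightarrow> ('a \<Rightarrow> 'b::comm_semiring_1) \<Rightarrow> 'b" where
  "edge_poly G x = (\<Sum>e\<in>edges G. \<Prod>w\<in>e. x w)"

lemma uniform_hypergraphD:
  assumes "uniform_hypergraph k G"
  shows "finite (verts G)" and "finite (edges G)"
    and "\<And>e. e \<in> edges G \<Longrightarrow> e \<subseteq> verts G"
    and "\<And>e. e \<in> edges G \<Longrightarrow> card e = k"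
    and "\<And>e. e \<in> edges G \<Longrightarrow> finite e"
proof -
  show V: "finite (verts G)" and sub: "\<And>e. e \<in> edges G \<Longrightarrow> e \<subseteq> verts G"
    and "\<And>e. e \<in> edges G \<Longrightarrow> card e = k"
    using assms by (auto simp: uniform_hypergraph_def)
  have "edges G \<subseteq> Pow (verts G)" using sub by blast
  then show "finite (edges G)" using V by (auto intro: finite_subset)
  show "\<And>e. e \<in> edges G \<Longrightarrow> finite e" using sub V finite_subset by blast
qed

lemma uniform_delete_verts:
  "uniform_hypergraph k G \<Longrightarrow> uniform_hypergraph k (delete_verts G I)"
  by (auto simp: uniform_hypergraph_def delete_verts_def)

lemma edge_poly_cong:
  assumes "uniform_hypergraph k G" "\<And>v. v \<in> verts G \<Longrightarrow> x v = y v"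
  shows "edge_poly G x = edge_poly G y"
  unfolding edge_poly_def
  by (intro sum.cong refl prod.cong assms(2)) (use uniform_hypergraphD(3)[OF assms(1)] in blast)

lemma edge_poly_scale:
  assumes "uniform_hypergraph k G"
  shows "edge_poly G (\<lambda>v. c * x v) = c ^ k * edge_poly G x"
  using uniform_hypergraphD(4)[OF assms]
  by (simp add: edge_poly_def prod.distrib sum_distrib_left)

lemma prod_edge_nonneg:
  fixes x :: "'a \<Rightarrow> 'b::linordered_idom"
  assumes "uniform_hypergraph k G" "\<forall>v\<in>verts G. 0 \<le> x v" "e \<in> edges G"
  shows "0 \<le> (\<Prod>w\<in>e. x w)"
  using assms uniform_hypergraphD(3) by (intro prod_nonneg) blast

lemma edge_poly_nonneg:
  fixes x :: "'a \<Rightarrow> 'b::linordered_idom"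
  assumes "uniform_hypergraph k G" "\<forall>v\<in>verts G. 0 \<le> x v"
  shows "0 \<le> edge_poly G x"
  unfolding edge_poly_def using prod_edge_nonneg[OF assms] by (intro sum_nonneg)

text \<open>
  No edge repeats a vertex, so the polynomial has degree at most one in each variable.  This
  reduces the optimality conditions at a maximizer to one-variable calculus; the slope is the
  right-hand side of the eigenvalue equation at \<open>u\<close>.
\<close>

lemma edge_poly_affine:
  assumes G: "uniform_hypergraph k G"
  shows "edge_poly G (x(u := t)) =
    (\<Sum>e | e \<in> edges G \<and> u \<notin> e. \<Prod>w\<in>e. x w) + t * (\<Sum>e | e \<in> edges G \<and> u \<in> e. \<Prod>w\<in>e - {u}. x w)"
proof -
  note [simp] = uniform_hypergraphD(2)[OF G]
  have split: "edges G = {e \<in> edges G. u \<notin> e} \<union> {e \<in> edges G. u \<in> e}" by auto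
  have "edge_poly G (x(u := t)) = (\<Sum>e | e \<in> edges G \<and> u \<notin> e. \<Prod>w\<in>e. (x(u := t)) w)
      + (\<Sum>e | e \<in> edges G \<and> u \<in> e. \<Prod>w\<in>e. (x(u := t)) w)"
    unfolding edge_poly_def by (subst split, rule sum.union_disjoint) auto
  also have "(\<Sum>e | e \<in> edges G \<and> u \<notin> e. \<Prod>w\<in>e. (x(u := t)) w)
      = (\<Sum>e | e \<in> edges G \<and> u \<notin> e. \<Prod>w\<in>e. x w)"
    by (intro sum.cong refl prod.cong) auto
  also have "(\<Sum>e | e \<in> edges G \<and> u \<in> e. \<Prod>w\<in>e. (x(u := t)) w)
      = (\<Sum>e | e \<in> edges G \<and> u \<in> e. t * (\<Prod>w\<in>e - {u}. x w))"
  proof (intro sum.cong refl)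
    fix e assume "e \<in> {e \<in> edges G. u \<in> e}"
    then have "(\<Prod>w\<in>e. (x(u := t)) w) = t * (\<Prod>w\<in>e - {u}. (x(u := t)) w)"
      using uniform_hypergraphD(5)[OF G, of e] by (subst prod.remove[of e u]) auto
    also have "(\<Prod>w\<in>e - {u}. (x(u := t)) w) = (\<Prod>w\<in>e - {u}. x w)"
      by (intro prod.cong) auto
    finally show "(\<Prod>w\<in>e. (x(u := t)) w) = t * (\<Prod>w\<in>e - {u}. x w)" .
  qed
  finally show ?thesis unfolding sum_distrib_left .
qed

lemma sum_incident_edges:
  fixes g :: "'a set \<Rightarrow> 'b::comm_semiring_1"
  assumes "uniform_hypergraph k G" "finite I"
  shows "(\<Sum>u\<in>I. \<Sum>e | e \<in> edges G \<and> u \<in> e. g e) = (\<Sum>e\<in>edges G. of_nat (card (e \<inter> I)) * g e)"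
proof -
  have "(\<Sum>u\<in>I. \<Sum>e | e \<in> edges G \<and> u \<in> e. g e) = (\<Sum>e\<in>edges G. \<Sum>u | u \<in> I \<and> u \<in> e. g e)"
    using assms uniform_hypergraphD(2) by (intro sum.swap_restrict) auto
  also have "\<dots> = (\<Sum>e\<in>edges G. of_nat (card (e \<inter> I)) * g e)"
    by (intro sum.cong refl) (simp add: Int_def conj_commute)
  finally show ?thesis .
qed

lemma prod_edge_remove:
  assumes "uniform_hypergraph k G" "u \<in> e" "e \<in> edges G"
  shows "x u * (\<Prod>w\<in>e - {u}. x w) = (\<Prod>w\<in>e. x w)"
  using uniform_hypergraphD(5)[OF assms(1,3)] assms(2) by (simp add: prod.remove)

lemma sum_edge_gradient:
  fixes x :: "'a \<Rightarrow> 'b::comm_semiring_1"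
  assumes "uniform_hypergraph k G" "finite I"
  shows "(\<Sum>u\<in>I. x u * (\<Sum>e | e \<in> edges G \<and> u \<in> e. \<Prod>w\<in>e - {u}. x w))
    = (\<Sum>e\<in>edges G. of_nat (card (e \<inter> I)) * (\<Prod>w\<in>e. x w))"
proof -
  have "x u * (\<Sum>e | e \<in> edges G \<and> u \<in> e. \<Prod>w\<in>e - {u}. x w) = (\<Sum>e | e \<in> edges G \<and> u \<in> e. \<Prod>w\<in>e. x w)" for u
    unfolding sum_distrib_left by (intro sum.cong refl) (use prod_edge_remove[OF assms(1)] in auto)
  then show ?thesis by (simp add: sum_incident_edges[OF assms])
qed

text \<open>
  This is the eigenvalue equation at \<open>i\<close> multiplied by \<open>x\<^sub>i\<close>, summed over \<open>I\<close>, with the order of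
  summation exchanged.
\<close>

lemma eigenpair_sum_over:
  fixes x :: "'a \<Rightarrow> 'b::field_char_0"
  assumes G: "uniform_hypergraph k G" and k: "k \<ge> 1"
    and x: "eigenpair k (verts G) (adjacency_tensor k G) \<mu> x" and I: "I \<subseteq> verts G"
  shows "\<mu> * (\<Sum>i\<in>I. x i ^ k) = (\<Sum>e\<in>edges G. of_nat (card (e \<inter> I)) * (\<Prod>w\<in>e. x w))"
proof -
  have fin: "finite I" using I uniform_hypergraphD(1)[OF G] finite_subset by blast
  have "\<mu> * (\<Sum>i\<in>I. x i ^ k) = (\<Sum>i\<in>I. x i * (\<mu> * x i ^ (k - 1)))"
    using k by (simp add: sum_distrib_left mult.left_commute flip: power_Suc)
  also have "\<dots> = (\<Sum>i\<in>I. x i * (\<Sum>e | e \<in> edges G \<and> i \<in> e. \<Prod>w\<in>e - {i}. x w))"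
    by (intro sum.cong refl) (use x I in \<open>auto simp: eigenpair_adjacency_tensor_iff[OF G k]\<close>)
  finally show ?thesis by (simp add: sum_edge_gradient[OF G fin])
qed

lemma eigenpair_edge_poly:
  fixes x :: "'a \<Rightarrow> 'b::field_char_0"
  assumes G: "uniform_hypergraph k G" and k: "k \<ge> 1"
    and x: "eigenpair k (verts G) (adjacency_tensor k G) \<mu> x"
  shows "\<mu> * (\<Sum>i\<in>verts G. x i ^ k) = of_nat k * edge_poly G x"
proof -
  have "of_nat (card (e \<inter> verts G)) = (of_nat k :: 'b)" if "e \<in> edges G" for e
    using uniform_hypergraphD(3,4)[OF G that] by (simp add: Int_absorb2)
  then show ?thesis
    unfolding eigenpair_sum_over[OF G k x order.refl]
    by (simp add: edge_poly_def sum_distrib_left)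
qed

section \<open>The spectral radius as a constrained maximum\<close>

text \<open>
  Compactness yields a maximizer on the unit sphere of the nonnegative orthant.  The maximality is
  recorded in homogeneous form, for all nonnegative \<open>z\<close>, because this form can be tested
  on perturbations without normalizing them.
\<close>

lemma edge_poly_maximizer:
  assumes G: "uniform_hypergraph k G" and k: "k \<ge> 1" and ne: "verts G \<noteq> {}"
  obtains y :: "'a \<Rightarrow> real" where "\<forall>v\<in>verts G. 0 \<le> y v" "(\<Sum>v\<in>verts G. y v ^ k) = 1"
    "\<And>z. \<forall>v\<in>verts G. 0 \<le> z v \<Longrightarrow> edge_poly G z \<le> edge_poly G y * (\<Sum>v\<in>verts G. z v ^ k)"
proof -
  note [simp] = uniform_hypergraphD(1)[OF G]
  let ?V = "verts G"
  let ?N = "\<lambda>y::'a \<Rightarrow> real. \<Sum>v\<in>?V. y v ^ k"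
  \<comment> \<open>Coordinates outside the vertex set are pinned to \<open>0\<close>: otherwise the box would not be compact
    in the product topology over the whole type.\<close>
  define B :: "('a \<Rightarrow> real) set" where "B = PiE UNIV (\<lambda>v. if v \<in> ?V then {0..1} else {0})"
  define K where "K = B \<inter> {y. ?N y = 1}"
  have "compactin (product_topology (\<lambda>v. euclidean) UNIV) B"
    unfolding B_def by (subst compactin_PiE) auto
  then have "compact B"
    unfolding euclidean_product_topology compactin_euclidean_iff .
  moreover have coord: "continuous_on S (\<lambda>y::'a \<Rightarrow> real. y v)" for v S
    by (rule continuous_on_subset[OF continuous_on_product_coordinates]) simp
  have "closed {y. ?N y = 1}"
    by (intro closed_Collect_eq continuous_intros coord)
  ultimately have K: "compact K" unfolding K_def by (rule compact_Int_closed)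
  obtain u where u: "u \<in> ?V" using ne by blast
  have "(\<Sum>v\<in>?V. (if v = u then 1 else 0 :: real) ^ k) = (\<Sum>v\<in>?V. if v = u then 1 else 0)"
    using k by (intro sum.cong) (auto simp: zero_power)
  then have "(\<lambda>v. if v = u then 1 else 0) \<in> K"
    using u by (auto simp: K_def B_def)
  then have "K \<noteq> {}" by blast
  moreover have "continuous_on K (edge_poly G)"
    unfolding edge_poly_def by (intro continuous_intros coord)
  ultimately obtain y where y: "y \<in> K" "\<forall>z\<in>K. edge_poly G z \<le> edge_poly G y"
    using continuous_attains_sup[OF K] by blast
  show thesis
  proof (rule that)
    show "\<forall>v\<in>?V. 0 \<le> y v"
    proof
      fix v assume "v \<in> ?V"
      moreover have "y v \<in> (if v \<in> ?V then {0..1} else {0})"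
        using y(1) unfolding K_def B_def by blast
      ultimately show "0 \<le> y v" by simp
    qed
    show "?N y = 1" using y(1) by (simp add: K_def)
  next
    fix z :: "'a \<Rightarrow> real" assume z: "\<forall>v\<in>?V. 0 \<le> z v"
    have Nz: "0 \<le> ?N z" using z by (intro sum_nonneg) auto
    show "edge_poly G z \<le> edge_poly G y * ?N z"
    proof (cases "?N z = 0")
      case True
      then have "\<forall>v\<in>?V. z v ^ k = 0" using z by (subst (asm) sum_nonneg_eq_0_iff) auto
      then have "\<And>v. v \<in> ?V \<Longrightarrow> z v = 0 * z v" by simp
      then have "edge_poly G z = edge_poly G (\<lambda>v. 0 * z v)" by (rule edge_poly_cong[OF G])
      also have "\<dots> = 0" using k by (simp only: edge_poly_scale[OF G]) simp
      finally show ?thesis using True by simp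
    next
      case False
      define c where "c = root k (?N z)"
      have c: "c > 0" "c ^ k = ?N z" using False Nz k by (auto simp: c_def)
      define z' where "z' = (\<lambda>v. if v \<in> ?V then inverse c * z v else 0)"
      have N1: "?N z' = 1"
      proof -
        have "?N z' = (\<Sum>v\<in>?V. inverse (c ^ k) * z v ^ k)"
          by (intro sum.cong) (auto simp: z'_def power_mult_distrib power_inverse)
        also have "\<dots> = inverse (c ^ k) * ?N z" by (simp add: sum_distrib_left)
        finally show ?thesis using c False by simp
      qed
      have z'0: "\<forall>v\<in>?V. 0 \<le> z' v" using z c by (auto simp: z'_def)
      have "z' v \<le> 1" if "v \<in> ?V" for v
      proof -
        have "z' v ^ k \<le> ?N z'" using that z'0 by (intro member_le_sum) auto
        then have "z' v ^ k \<le> 1 ^ k" using N1 by simp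
        then show ?thesis using k by (subst (asm) power_mono_iff) (use z'0 that in auto)
      qed
      then have "z' \<in> K" using z'0 N1 by (auto simp: K_def B_def z'_def)
      then have "edge_poly G z' \<le> edge_poly G y" using y by blast
      moreover have "edge_poly G z' = edge_poly G (\<lambda>v. inverse c * z v)"
        by (rule edge_poly_cong[OF G]) (simp add: z'_def)
      then have "edge_poly G z' = edge_poly G z / ?N z"
        by (simp add: edge_poly_scale[OF G] power_inverse c divide_inverse mult.commute)
      ultimately show ?thesis using False Nz by (simp add: divide_le_eq)
    qed
  qed
qed

text \<open>
  Vary a single coordinate \<open>y\<^sub>u\<close> over \<open>t \<ge> 0\<close>.  The defect \<open>f t\<close> between the two sides of the maximality
  inequality is nonpositive and vanishes at \<open>t = y\<^sub>u\<close>.  If \<open>y\<^sub>u > 0\<close>, this is an interior maximum and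
  \<open>f' = 0\<close> is the eigenvalue equation.  If \<open>y\<^sub>u = 0\<close>, only \<open>f' \<le> 0\<close> is available, but \<open>t\<^sup>k\<close> has derivative
  \<open>0\<close> there since \<open>k \<ge> 2\<close>, so the nonnegative slope of the edge polynomial must vanish and the equation
  holds again.
\<close>

lemma maximizer_eigenpair:
  fixes y :: "'a \<Rightarrow> real"
  assumes G: "uniform_hypergraph k G" and k: "k \<ge> 2"
    and y0: "\<forall>v\<in>verts G. 0 \<le> y v" and y1: "(\<Sum>v\<in>verts G. y v ^ k) = 1"
    and max: "\<And>z. \<forall>v\<in>verts G. 0 \<le> z v \<Longrightarrow> edge_poly G z \<le> edge_poly G y * (\<Sum>v\<in>verts G. z v ^ k)"
  shows "eigenpair k (verts G) (adjacency_tensor k G) (real k * edge_poly G y) y"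
proof -
  note [simp] = uniform_hypergraphD(1)[OF G]
  let ?V = "verts G"
  let ?M = "edge_poly G y"
  have k1: "k \<ge> 1" using k by simp
  have "\<exists>u\<in>?V. y u \<noteq> 0"
  proof (rule ccontr)
    assume "\<not> ?thesis"
    then have "(\<Sum>v\<in>?V. y v ^ k) = 0" using k by (intro sum.neutral) auto
    then show False using y1 by simp
  qed
  moreover have "real k * ?M * y u ^ (k - 1) = (\<Sum>e | e \<in> edges G \<and> u \<in> e. \<Prod>w\<in>e - {u}. y w)"
    if u: "u \<in> ?V" for u
  proof -
    define C where "C = (\<Sum>e | e \<in> edges G \<and> u \<in> e. \<Prod>w\<in>e - {u}. y w)"
    define D where "D = (\<Sum>e | e \<in> edges G \<and> u \<notin> e. \<Prod>w\<in>e. y w)"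
    define B where "B = (\<Sum>v\<in>?V - {u}. y v ^ k)"
    define f where "f t = (D + t * C) - ?M * (t ^ k + B)" for t
    have N: "(\<Sum>v\<in>?V. (y(u := t)) v ^ k) = t ^ k + B" for t
      using u by (simp add: sum.remove[of ?V u] B_def)
    have f_eq: "f t = edge_poly G (y(u := t)) - ?M * (\<Sum>v\<in>?V. (y(u := t)) v ^ k)" for t
      by (simp only: N edge_poly_affine[OF G] f_def C_def D_def)
    have f_le: "f t \<le> 0" if "t \<ge> 0" for t
      unfolding f_eq using max[of "y(u := t)"] y0 that by simp
    have f_y: "f (y u) = 0" unfolding f_eq by (simp add: y1)
    have C0: "C \<ge> 0"
      unfolding C_def by (intro sum_nonneg prod_nonneg) (use y0 uniform_hypergraphD(3)[OF G] in blast)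
    have yu: "0 \<le> y u" using u y0 by blast
    have der: "(f has_real_derivative (C - ?M * (real k * y u ^ (k - 1)))) (at (y u))"
      unfolding f_def by (auto intro!: derivative_eq_intros)
    have le: "C \<le> ?M * (real k * y u ^ (k - 1))"
    proof (rule ccontr)
      assume "\<not> ?thesis"
      then obtain d where "d > 0" "\<forall>h>0. h < d \<longrightarrow> f (y u) < f (y u + h)"
        using DERIV_pos_inc_right[OF der] by auto
      then have "f (y u) < f (y u + d / 2)" by auto
      then show False using f_y f_le[of "y u + d / 2"] yu \<open>d > 0\<close> by simp
    qed
    have "C = ?M * (real k * y u ^ (k - 1))"
    proof (cases "y u = 0")
      case True
      then show ?thesis using le C0 k by (simp add: zero_power)
    next
      case False
      then have pos: "y u > 0" using yu by simp
      have "C - ?M * (real k * y u ^ (k - 1)) = 0"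
        by (rule DERIV_local_max[OF der pos]) (use f_le f_y in auto)
      then show ?thesis by simp
    qed
    then show ?thesis unfolding C_def by (simp add: mult_ac)
  qed
  ultimately show ?thesis unfolding eigenpair_adjacency_tensor_iff[OF G k1] by blast
qed

lemma eigenvalue_norm_bound:
  fixes \<mu> :: complex
  assumes G: "uniform_hypergraph k G" and k: "k \<ge> 1"
    and x: "eigenpair k (verts G) (adjacency_tensor k G) \<mu> x"
  shows "cmod \<mu> * (\<Sum>v\<in>verts G. cmod (x v) ^ k) \<le> real k * edge_poly G (\<lambda>v. cmod (x v))"
proof -
  note [simp] = uniform_hypergraphD(1)[OF G]
  let ?a = "\<lambda>v. cmod (x v)"
  have "cmod \<mu> * (\<Sum>v\<in>verts G. ?a v ^ k) = (\<Sum>v\<in>verts G. ?a v * cmod (\<mu> * x v ^ (k - 1)))"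
    using k by (simp add: sum_distrib_left norm_mult norm_power mult.left_commute flip: power_Suc)
  also have "\<dots> \<le> (\<Sum>v\<in>verts G. ?a v * (\<Sum>e | e \<in> edges G \<and> v \<in> e. \<Prod>w\<in>e - {v}. ?a w))"
  proof (intro sum_mono mult_left_mono)
    fix v assume "v \<in> verts G"
    then have "\<mu> * x v ^ (k - 1) = (\<Sum>e | e \<in> edges G \<and> v \<in> e. \<Prod>w\<in>e - {v}. x w)"
      using x by (auto simp: eigenpair_adjacency_tensor_iff[OF G k])
    then show "cmod (\<mu> * x v ^ (k - 1)) \<le> (\<Sum>e | e \<in> edges G \<and> v \<in> e. \<Prod>w\<in>e - {v}. ?a w)"
      by (simp add: sum_norm_le prod_norm)
  qed simp
  also have "\<dots> = (\<Sum>e\<in>edges G. real (card (e \<inter> verts G)) * (\<Prod>w\<in>e. ?a w))"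
    by (rule sum_edge_gradient[OF G]) simp
  also have "\<dots> = (\<Sum>e\<in>edges G. real k * (\<Prod>w\<in>e. ?a w))"
    by (intro sum.cong refl)
      (use uniform_hypergraphD(3,4)[OF G] in \<open>simp add: Int_absorb2\<close>)
  finally show ?thesis by (simp add: edge_poly_def sum_distrib_left)
qed

text \<open>
  The maximum value is itself an eigenvalue and dominates the modulus of every other one.  In
  particular the greatest modulus exists, so \<open>spectral_radius\<close> is determined by its definition.
\<close>

theorem spectral_radius_variational:
  fixes G :: "'a hypergraph"
  assumes G: "uniform_hypergraph k G" and k: "k \<ge> 2" and ne: "verts G \<noteq> {}"
  shows "\<exists>y. (\<forall>v\<in>verts G. 0 \<le> y v) \<and> (\<Sum>v\<in>verts G. y v ^ k) = 1
      \<and> real k * edge_poly G y = spectral_radius k G"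
    and "\<forall>v\<in>verts G. 0 \<le> z v \<Longrightarrow>
      real k * edge_poly G z \<le> spectral_radius k G * (\<Sum>v\<in>verts G. z v ^ k)"
proof -
  have k1: "k \<ge> 1" using k by simp
  obtain y :: "'a \<Rightarrow> real" where y0: "\<forall>v\<in>verts G. 0 \<le> y v" and y1: "(\<Sum>v\<in>verts G. y v ^ k) = 1"
    and max: "\<And>z. \<forall>v\<in>verts G. 0 \<le> z v \<Longrightarrow> edge_poly G z \<le> edge_poly G y * (\<Sum>v\<in>verts G. z v ^ k)"
    using edge_poly_maximizer[OF G k1 ne] by blast
  define M where "M = real k * edge_poly G y"
  have M0: "M \<ge> 0" unfolding M_def using edge_poly_nonneg[OF G y0] by simp
  have maxM: "real k * edge_poly G z \<le> M * (\<Sum>v\<in>verts G. z v ^ k)" if "\<forall>v\<in>verts G. 0 \<le> z v" for z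
    using mult_left_mono[OF max[OF that], of "real k"] by (simp add: M_def mult.assoc)
  have real_pair: "eigenpair k (verts G) (adjacency_tensor k G) M y"
    unfolding M_def by (rule maximizer_eigenpair[OF G k y0 y1 max])
  have cpair: "eigenpair k (verts G) (adjacency_tensor k G) (complex_of_real M) (\<lambda>v. complex_of_real (y v))"
    using real_pair unfolding eigenpair_adjacency_tensor_iff[OF G k1]
    by (simp flip: of_real_power of_real_mult of_real_prod of_real_sum)
  have bound: "cmod \<mu> \<le> M" if x: "eigenpair k (verts G) (adjacency_tensor k G) \<mu> x" for \<mu> x
  proof -
    have "cmod \<mu> * (\<Sum>v\<in>verts G. cmod (x v) ^ k) \<le> M * (\<Sum>v\<in>verts G. cmod (x v) ^ k)"
      using eigenvalue_norm_bound[OF G k1 x] maxM[of "\<lambda>v. cmod (x v)"] by simp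
    moreover obtain u where "u \<in> verts G" "x u \<noteq> 0" using x by (auto simp: eigenpair_def)
    then have "(\<Sum>v\<in>verts G. cmod (x v) ^ k) > 0"
      using uniform_hypergraphD(1)[OF G] by (intro sum_pos2[of _ u]) auto
    ultimately show ?thesis by simp
  qed
  have \<rho>: "spectral_radius k G = M"
    unfolding spectral_radius_def
  proof (rule Greatest_equality)
    show "\<exists>\<mu>::complex. (\<exists>x. eigenpair k (verts G) (adjacency_tensor k G) \<mu> x) \<and> M = cmod \<mu>"
      using cpair M0 by (intro exI[of _ "complex_of_real M"]) auto
  qed (use bound in blast)
  show "\<exists>y. (\<forall>v\<in>verts G. 0 \<le> y v) \<and> (\<Sum>v\<in>verts G. y v ^ k) = 1
      \<and> real k * edge_poly G y = spectral_radius k G"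
    by (intro exI[of _ y]) (use y0 y1 in \<open>simp add: \<rho> M_def\<close>)
  show "real k * edge_poly G z \<le> spectral_radius k G * (\<Sum>v\<in>verts G. z v ^ k)"
    if "\<forall>v\<in>verts G. 0 \<le> z v"
    using maxM[OF that] by (simp add: \<rho>)
qed

lemma spectral_radius_nonneg:
  assumes "uniform_hypergraph k G" "k \<ge> 2" "verts G \<noteq> {}"
  shows "spectral_radius k G \<ge> 0"
  using spectral_radius_variational(1)[OF assms] edge_poly_nonneg[OF assms(1)]
  by (metis mult_nonneg_nonneg of_nat_0_le_iff)

section \<open>Positivity of the principal eigenvector of a connected hypergraph\<close>

lemma hyper_connected_crossing_edge:
  assumes G: "uniform_hypergraph k G" and con: "hyper_connected G"
    and "a \<in> verts G" "P a" "b \<in> verts G" "\<not> P b"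
  obtains e u v where "e \<in> edges G" "u \<in> e" "P u" "v \<in> e" "\<not> P v"
proof -
  have "(a, b) \<in> {(a, b). \<exists>e\<in>edges G. a \<in> e \<and> b \<in> e}\<^sup>*"
    using con assms unfolding hyper_connected_def by blast
  then have "\<exists>e\<in>edges G. \<exists>u\<in>e. \<exists>v\<in>e. P u \<and> \<not> P v"
    using \<open>P a\<close> \<open>\<not> P b\<close>
  proof (induction rule: rtrancl_induct)
    case (step y z)
    then show ?case by (cases "P y") blast+
  qed simp
  then show thesis using that by blast
qed

text \<open>
  For hypergraphs, vanishing of \<open>x\<close> at a vertex does not propagate to its neighbours through the
  eigenvalue equations: one other zero in each edge at that vertex is enough to satisfy them.
  Instead, the variational formula is used: \<open>x\<close> attains the maximum.  If \<open>x\<close> had zeros, some edge \<open>e\<close> would contain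
  both zeros and nonzeros of \<open>x\<close>.  Raising its \<open>m < k\<close> zeros to \<open>t > 0\<close> increases the edge polynomial by
  at least a positive multiple of \<open>t\<^sup>m\<close>, but the \<open>k\<close>-th power sum only by \<open>m t\<^sup>k\<close>, which contradicts maximality
  for small \<open>t\<close>.
\<close>

lemma principal_eigenvector_pos:
  fixes x :: "'a \<Rightarrow> real"
  assumes G: "uniform_hypergraph k G" and k: "k \<ge> 2" and con: "hyper_connected G"
    and x: "eigenpair k (verts G) (adjacency_tensor k G) (spectral_radius k G) x"
    and x0: "\<forall>v\<in>verts G. 0 \<le> x v" and v: "v \<in> verts G"
  shows "x v > 0"
proof (rule ccontr)
  assume "\<not> x v > 0"
  moreover obtain a where "a \<in> verts G" "x a \<noteq> 0" using x by (auto simp: eigenpair_def)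
  then have "a \<in> verts G" "x a > 0" using x0 by force+
  ultimately obtain e p q where e: "e \<in> edges G" "p \<in> e" "x p > 0" "q \<in> e" "\<not> x q > 0"
    using hyper_connected_crossing_edge[OF G con, of a "\<lambda>v. x v > 0" v] v by blast
  note fin = uniform_hypergraphD[OF G]
  have esub: "e \<subseteq> verts G" and efin: "finite e" using fin e by auto
  define Z where "Z = {w \<in> e. x w = 0}"
  define m where "m = card Z"
  define c where "c = (\<Prod>w\<in>e - Z. x w)"
  define \<rho> where "\<rho> = spectral_radius k G"
  have Zsub: "Z \<subseteq> e" by (auto simp: Z_def)
  have Zfin: "finite Z" using Zsub efin finite_subset by blast
  have "p \<notin> Z" using e by (auto simp: Z_def)
  then have "Z \<subset> e" using Zsub e by blast
  then have mk: "m < k" using fin(4)[OF e(1)] efin psubset_card_mono m_def by metis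
  have c: "c > 0" unfolding c_def
  proof (rule prod_pos)
    fix w assume "w \<in> e - Z"
    then show "0 < x w" using x0 esub by (force simp: Z_def)
  qed
  have perturb: "real k * c * t ^ m \<le> \<rho> * real m * t ^ k" if t: "t > 0" for t
  proof -
    define y where "y = (\<lambda>w. if w \<in> Z then t else x w)"
    have y0: "\<forall>v\<in>verts G. 0 \<le> y v" using x0 t by (auto simp: y_def)
    have xy: "x w \<le> y w" for w using t by (auto simp: y_def Z_def)
    have "(\<Prod>w\<in>e. y w) = (\<Prod>w\<in>e - Z. y w) * (\<Prod>w\<in>Z. y w)"
      by (rule prod.subset_diff[OF Zsub efin])
    also have "(\<Prod>w\<in>e - Z. y w) = c" unfolding c_def by (intro prod.cong) (auto simp: y_def)
    also have "(\<Prod>w\<in>Z. y w) = t ^ m" by (simp add: y_def m_def)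
    finally have ye: "(\<Prod>w\<in>e. y w) = c * t ^ m" .
    have xe: "(\<Prod>w\<in>e. x w) = 0"
      using efin e x0 esub by (intro prod_zero) force+
    have "(\<Sum>f\<in>edges G - {e}. \<Prod>w\<in>f. x w) \<le> (\<Sum>f\<in>edges G - {e}. \<Prod>w\<in>f. y w)"
      by (intro sum_mono prod_mono) (use x0 xy fin(3) in blast)
    then have "edge_poly G x + c * t ^ m \<le> edge_poly G y"
      unfolding edge_poly_def using fin(2) e by (simp add: sum.remove[of _ e] xe ye)
    then have "real k * edge_poly G x + real k * (c * t ^ m) \<le> real k * edge_poly G y"
      by (metis distrib_left mult_left_mono of_nat_0_le_iff)
    also have "\<dots> \<le> \<rho> * (\<Sum>v\<in>verts G. y v ^ k)"
      unfolding \<rho>_def using spectral_radius_variational(2)[OF G k _ y0] v by blast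
    also have "(\<Sum>v\<in>verts G. y v ^ k) = (\<Sum>v\<in>verts G. x v ^ k + (if v \<in> Z then t ^ k else 0))"
      using k by (intro sum.cong) (auto simp: y_def Z_def)
    also have "\<dots> = (\<Sum>v\<in>verts G. x v ^ k) + real m * t ^ k"
      using fin(1) esub Zsub by (simp add: sum.distrib m_def Int_absorb1 flip: sum.inter_restrict)
    finally show ?thesis
      using eigenpair_edge_poly[OF G _ x] k by (simp add: algebra_simps \<rho>_def)
  qed
  have \<rho>0: "\<rho> \<ge> 0" unfolding \<rho>_def using spectral_radius_nonneg[OF G k] v by blast
  \<comment> \<open>It suffices that \<open>t \<le> 1\<close> and \<open>\<rho> m t < c\<close>; the summand \<open>1\<close> makes the denominator positive
    and the inequality strict.\<close>
  define t where "t = min 1 (c / (\<rho> * real m + 1))"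
  have d: "\<rho> * real m + 1 > 0" using \<rho>0 by (simp add: add_nonneg_pos)
  then have t: "0 < t" "t \<le> 1" "t * (\<rho> * real m + 1) \<le> c"
    using c by (auto simp: t_def pos_le_divide_eq[symmetric])
  have "t ^ m * (real k * c) \<le> t ^ m * (\<rho> * real m * t ^ (k - m))"
    using perturb[OF t(1)] mk by (simp add: mult_ac flip: power_add)
  then have "real k * c \<le> \<rho> * real m * t ^ (k - m)" using t by simp
  also have "\<dots> \<le> \<rho> * real m * t ^ 1"
    using t mk \<rho>0 by (intro mult_left_mono power_decreasing) auto
  also have "\<dots> < c" using t by (simp add: algebra_simps)
  also have "\<dots> \<le> real k * c" using c k by simp
  finally show False by simp
qed

section \<open>Deleting vertices\<close>

lemma spectral_radius_delete_le:
  assumes G: "uniform_hypergraph k G" and k: "k \<ge> 2" and ne: "\<not> verts G \<subseteq> I"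
  shows "spectral_radius k (delete_verts G I) \<le> spectral_radius k G"
proof -
  note fin = uniform_hypergraphD[OF G]
  let ?H = "delete_verts G I"
  have V: "verts ?H = verts G - I" and E: "edges ?H = {e \<in> edges G. e \<inter> I = {}}"
    by (simp_all add: delete_verts_def)
  obtain y where y: "\<forall>v\<in>verts ?H. 0 \<le> y v" "(\<Sum>v\<in>verts ?H. y v ^ k) = 1"
    "real k * edge_poly ?H y = spectral_radius k ?H"
    using spectral_radius_variational(1)[OF uniform_delete_verts[OF G] k, of I] ne by (auto simp: V)
  define z where "z = (\<lambda>v. if v \<in> I then 0 else y v)"
  have z0: "\<forall>v\<in>verts G. 0 \<le> z v" using y by (auto simp: z_def V)
  have "edge_poly ?H y = edge_poly ?H z"
    by (rule edge_poly_cong[OF uniform_delete_verts[OF G]]) (auto simp: z_def V)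
  also have "\<dots> \<le> edge_poly G z"
    unfolding edge_poly_def using fin(2) prod_edge_nonneg[OF G z0] by (intro sum_mono2) (auto simp: E)
  finally have "spectral_radius k ?H \<le> real k * edge_poly G z"
    unfolding y(3)[symmetric] by (intro mult_left_mono) auto
  also have "\<dots> \<le> spectral_radius k G * (\<Sum>v\<in>verts G. z v ^ k)"
    by (rule spectral_radius_variational(2)[OF G k _ z0]) (use ne in blast)
  also have "(\<Sum>v\<in>verts G. z v ^ k) = (\<Sum>v\<in>verts ?H. z v ^ k)"
    using fin(1) k by (intro sum.mono_neutral_right) (auto simp: V z_def)
  also have "\<dots> = 1" unfolding y(2)[symmetric] by (intro sum.cong) (auto simp: V z_def)
  finally show ?thesis by simp
qed

text \<open>
  An edge with \<open>c = |e \<inter> I|\<close> contributes \<open>1 - c\<close> to the first two terms, which is the wanted value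
  when \<open>c \<le> 1\<close>; the double sum adds back \<open>c - 1\<close> when \<open>c \<ge> 2\<close>.
\<close>

lemma edge_poly_delete_verts:
  fixes x :: "'a \<Rightarrow> real"
  assumes G: "uniform_hypergraph k G"
  shows "edge_poly (delete_verts G I) x = edge_poly G x
    - (\<Sum>e\<in>edges G. real (card (e \<inter> I)) * (\<Prod>w\<in>e. x w))
    + (\<Sum>j = 2..k. \<Sum>e | e \<in> edges G \<and> card (e \<inter> I) = j. (real j - 1) * (\<Prod>w\<in>e. x w))"
proof -
  note fin = uniform_hypergraphD[OF G]
  let ?p = "\<lambda>e. \<Prod>w\<in>e. x w"
  let ?c = "\<lambda>e. card (e \<inter> I)"
  have le: "?c e \<le> k" if "e \<in> edges G" for e
    using card_mono[OF fin(5)[OF that], of "e \<inter> I"] fin(4)[OF that] by simp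
  have "(\<Sum>j = 2..k. \<Sum>e | e \<in> edges G \<and> ?c e = j. (real j - 1) * ?p e)
      = (\<Sum>j = 2..k. \<Sum>e | e \<in> {e \<in> edges G. ?c e \<in> {2..k}} \<and> ?c e = j. (real (?c e) - 1) * ?p e)"
    by (intro sum.cong refl) auto
  also have "\<dots> = (\<Sum>e | e \<in> edges G \<and> ?c e \<in> {2..k}. (real (?c e) - 1) * ?p e)"
    by (rule sum.group) (use fin(2) in auto)
  also have "\<dots> = (\<Sum>e\<in>edges G. if 2 \<le> ?c e then (real (?c e) - 1) * ?p e else 0)"
    unfolding sum.inter_filter[OF fin(2), symmetric]
    by (rule sum.cong) (use le in auto)
  finally have S: "(\<Sum>j = 2..k. \<Sum>e | e \<in> edges G \<and> ?c e = j. (real j - 1) * ?p e)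
      = (\<Sum>e\<in>edges G. if 2 \<le> ?c e then (real (?c e) - 1) * ?p e else 0)" .
  have H: "edge_poly (delete_verts G I) x = (\<Sum>e\<in>edges G. if e \<inter> I = {} then ?p e else 0)"
    by (simp add: edge_poly_def delete_verts_def sum.inter_filter[OF fin(2)])
  have pointwise: "(if e \<inter> I = {} then ?p e else 0)
      = ?p e - real (?c e) * ?p e + (if 2 \<le> ?c e then (real (?c e) - 1) * ?p e else 0)"
    if "e \<in> edges G" for e
  proof -
    have disj: "e \<inter> I = {} \<longleftrightarrow> ?c e = 0" using fin(5)[OF that] by (simp add: card_eq_0_iff)
    consider "?c e = 0" | "?c e = 1" | "2 \<le> ?c e" by linarith
    then show ?thesis by cases (auto simp: disj algebra_simps)
  qed
  show ?thesis
    unfolding S H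
    unfolding edge_poly_def sum.distrib[symmetric] sum_subtractf[symmetric]
    by (rule sum.cong[OF refl pointwise])
qed

theorem theorem4p3:
  fixes n k :: nat and G :: "nat hypergraph" and x :: "nat \<Rightarrow> real" and I :: "nat set"
  assumes "n \<ge> k" and "k \<ge> 2"
    and "uniform_hypergraph k G" and "verts G = {1..n}"
    and "eigenpair k (verts G) (adjacency_tensor k G) (spectral_radius k G) x"
    and "unit_vector k (verts G) x" and "\<forall>i\<in>verts G. x i \<ge> 0"
    and "I \<noteq> {}" and "I \<subset> {1..n}"
  shows "spectral_radius k G * (1 - real k * (\<Sum>i\<in>I. x i ^ k))
           + real k * (\<Sum>j = 2..k. \<Sum>e | e \<in> edges G \<and> card (e \<inter> I) = j. (real j - 1) * (\<Prod>w\<in>e. x w))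
           \<le> spectral_radius k (delete_verts G I)
         \<and> spectral_radius k (delete_verts G I) \<le> spectral_radius k G
         \<and> ((\<Sum>i\<in>I. x i ^ k) \<noteq> 1 \<longrightarrow>
             (spectral_radius k G * (1 - real k * (\<Sum>i\<in>I. x i ^ k))
               + real k * (\<Sum>j = 2..k. \<Sum>e | e \<in> edges G \<and> card (e \<inter> I) = j. (real j - 1) * (\<Prod>w\<in>e. x w)))
               / (1 - (\<Sum>i\<in>I. x i ^ k))
             \<le> spectral_radius k (delete_verts G I)
           \<and> spectral_radius k (delete_verts G I) \<le> spectral_radius k G)
         \<and> (hyper_connected G \<longrightarrow> (\<Sum>i\<in>I. x i ^ k) \<noteq> 1)"
proof -
  note k = assms(2) and G = assms(3) and x = assms(5) and x0 = assms(7)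
  note fin = uniform_hypergraphD[OF G]
  let ?H = "delete_verts G I"
  let ?\<rho> = "spectral_radius k G"
  let ?\<rho>' = "spectral_radius k ?H"
  let ?J = "\<Sum>j = 2..k. \<Sum>e | e \<in> edges G \<and> card (e \<inter> I) = j. (real j - 1) * (\<Prod>w\<in>e. x w)"
  define S where "S = (\<Sum>i\<in>I. x i ^ k)"
  define L where "L = ?\<rho> * (1 - real k * S) + real k * ?J"
  have I: "I \<subseteq> verts G" and ne: "\<not> verts G \<subseteq> I" using assms(4,9) by auto
  have H: "uniform_hypergraph k ?H" by (rule uniform_delete_verts[OF G])
  have VH: "verts ?H = verts G - I" by (simp add: delete_verts_def)
  have neH: "verts ?H \<noteq> {}" using ne VH by auto
  have "(\<Sum>v\<in>verts G. x v ^ k) = 1"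
    using assms(6) x0 by (simp add: unit_vector_def)
  moreover have "(\<Sum>v\<in>verts G. x v ^ k) = (\<Sum>v\<in>verts G - I. x v ^ k) + S"
    unfolding S_def by (rule sum.subset_diff[OF I fin(1)])
  ultimately have unit: "(\<Sum>v\<in>verts G. x v ^ k) = 1" and rest: "(\<Sum>v\<in>verts G - I. x v ^ k) = 1 - S"
    by simp_all
  have S0: "0 \<le> S" unfolding S_def using x0 I by (intro sum_nonneg) auto
  have S1: "0 \<le> 1 - S" unfolding rest[symmetric] using x0 by (intro sum_nonneg) auto
  \<comment> \<open>The numerator of the lower bound is the objective of \<open>G - I\<close> at the restriction of \<open>x\<close>.\<close>
  have "L = real k * edge_poly ?H x"
    using eigenpair_edge_poly[OF G _ x] eigenpair_sum_over[OF G _ x I] k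
    unfolding L_def edge_poly_delete_verts[OF G] unit S_def by (simp add: algebra_simps)
  also have "\<dots> \<le> ?\<rho>' * (1 - S)"
    using spectral_radius_variational(2)[OF H k neH, of x] x0 by (simp add: VH rest)
  finally have main: "L \<le> ?\<rho>' * (1 - S)" .
  also have "\<dots> \<le> ?\<rho>' * 1"
    using spectral_radius_nonneg[OF H k neH] S0 by (intro mult_left_mono) auto
  finally have lower: "L \<le> ?\<rho>'" by simp
  have upper: "?\<rho>' \<le> ?\<rho>" by (rule spectral_radius_delete_le[OF G k ne])
  have ratio: "L / (1 - S) \<le> ?\<rho>'" if "S \<noteq> 1"
    using main S1 that by (simp add: pos_divide_le_eq)
  have conn: "S \<noteq> 1" if "hyper_connected G"
  proof -
    have "(\<Sum>v\<in>verts G - I. x v ^ k) > 0"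
      using fin(1) ne principal_eigenvector_pos[OF G k that x x0] by (intro sum_pos) auto
    then show ?thesis using rest by simp
  qed
  show ?thesis
    using lower upper ratio conn unfolding L_def S_def by blast
qed

end
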